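(* Let $A\in\mathbb{R}^{M\times N}$ and let $X\in\mathbb{R}^{N\times K}$ have rank $r\ge1$ and exactly $s$ nonzero rows. Assume $s<\operatorname{spark}(A)$ and that $A$ satisfies the $(r,s)$-spherical section property, or, equivalently, that $r\le s<\min\{\iota_r(A)^2/r,\ \operatorname{spark}(A)\}$. Then for sufficiently small $\delta^2/\alpha$ and $\alpha$ the following holds (i.e. there exist $c_0,\alpha_0>0$, depending on $A$ and $X$, such that it holds for all $\delta\ge0$, $\alpha>0$ with $\delta^2/\alpha\le c_0$, $\alpha\le\alpha_0$): for every $Y\in\mathbb{R}^{M\times K}$ with $\|Y-AX\|_{\mathrm{Fro}}\le\delta$, every (globally) minimizing sequence of $$\min_{Z\in\mathbb{R}^{N\times K}}\Big(\mathit{ow}\ell_{2,1}(Z)+\frac1{2\alpha}\|AZ-Y\|_{\mathrm{Fro}}^2\Big)$$ is bounded, and the set of optimal solutions of this problem is nonempty.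
   Context: $\|\cdot\|_{\mathrm{Fro}}$ is the Frobenius norm. $\operatorname{spark}(A)$ is the smallest number of linearly dependent columns of $A$ (convention: $+\infty$ if the columns are linearly independent). For $Z\in\mathbb{R}^{N\times K}$ with rows $z_n$ (as $1\times K$ vectors), $\mathit{ow}\ell_{2,1}(Z)=\sum_{n=1}^N\sqrt{z_n(Z^TZ)^\dagger z_n^T}$, with $(\cdot)^\dagger$ the Moore–Penrose pseudo-inverse. The rank-$r$ singularity set is $\Omega_r(A)=\{Z\in\mathbb{R}^{N\times K}:\operatorname{rank}(Z)\ge r,\ \operatorname{rank}(AZ)<\operatorname{rank}(Z)\}$, and $\iota_r(A)=\inf_{Z\in\Omega_r(A)}\mathit{ow}\ell_{2,1}(Z)$ (with $\inf\emptyset=+\infty$). $A$ satisfies the $(r,s)$-spherical section property if $\mathit{ow}\ell_{2,1}(Z)>\sqrt{rs}$ for all $Z\in\Omega_r(A)$. A minimizing sequence is a sequence along which the objective converges to its infimum. *)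

theory Defs
  imports "HOL-Analysis.Analysis"
begin

text \<open>A matrix in \<open>\<real>\<^bsup>M \<times> N\<^esup>\<close> has type \<open>real^'n^'m\<close>. The \<open>norm\<close> of this type is the Euclidean norm of the
  Euclidean norms of the rows, i.e. the Frobenius norm (not an operator norm).\<close>

definition is_pinv :: "real^'n^'m \<Rightarrow> real^'m^'n \<Rightarrow> bool" where
  "is_pinv A B \<longleftrightarrow>
     A ** B ** A = A \<and> B ** A ** B = B \<and>
     transpose (A ** B) = A ** B \<and> transpose (B ** A) = B ** A"

text \<open>Every real matrix has exactly one pseudo-inverse in the sense of the four Penrose equations.\<close>
definition pinv :: "real^'n^'m \<Rightarrow> real^'m^'n" where
  "pinv A = (THE B. is_pinv A B)"

definition owl21 :: "real^'k^'n \<Rightarrow> real" where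
  "owl21 Z = (\<Sum>n\<in>UNIV. sqrt (row n Z \<bullet> (pinv (transpose Z ** Z) *v row n Z)))"

text \<open>Dependence is that of the indexed family of columns, so that a repeated column gives a dependent
  pair; the set of columns would lose the multiplicity.\<close>
definition dependent_columns :: "real^'n^'m \<Rightarrow> 'n set \<Rightarrow> bool" where
  "dependent_columns A S \<longleftrightarrow>
     (\<exists>c :: 'n \<Rightarrow> real. (\<exists>j\<in>S. c j \<noteq> 0) \<and> (\<Sum>j\<in>S. c j *\<^sub>R column j A) = 0)"

text \<open>The infimum of the empty set in \<open>enat\<close> is \<open>\<infinity>\<close>.\<close>
definition spark :: "real^'n^'m \<Rightarrow> enat" where
  "spark A = (INF S\<in>{S. dependent_columns A S}. enat (card S))"

definition singularity_set :: "nat \<Rightarrow> real^'n^'m \<Rightarrow> (real^'k^'n) set" where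
  "singularity_set r A = {Z. rank Z \<ge> r \<and> rank (A ** Z) < rank Z}"

text \<open>The next two notions depend on the number \<open>K\<close> of columns of \<open>Z\<close>, which neither \<open>r\<close>, \<open>s\<close> nor \<open>A\<close>
  determines; it is passed as a type argument. The infimum of the empty set in \<open>ereal\<close> is \<open>\<infinity>\<close>.\<close>
definition iota :: "'k::finite itself \<Rightarrow> nat \<Rightarrow> real^'n^'m \<Rightarrow> ereal" where
  "iota _ r A = (INF Z\<in>(singularity_set r A :: (real^'k^'n) set). ereal (owl21 Z))"

definition spherical_section :: "'k::finite itself \<Rightarrow> nat \<Rightarrow> nat \<Rightarrow> real^'n^'m \<Rightarrow> bool" where
  "spherical_section _ r s A \<longleftrightarrow>
     (\<forall>Z\<in>(singularity_set r A :: (real^'k^'n) set). owl21 Z > sqrt (real r * real s))"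

definition objective :: "real \<Rightarrow> real^'n^'m \<Rightarrow> real^'k^'m \<Rightarrow> real^'k^'n \<Rightarrow> real" where
  "objective \<alpha> A Y Z = owl21 Z + 1 / (2 * \<alpha>) * (norm (A ** Z - Y))\<^sup>2"

text \<open>Meant for objectives that are bounded below, as the infimum is taken in \<open>\<real>\<close>;
  \<open>objective \<alpha> A Y\<close> is nonnegative for \<open>\<alpha> > 0\<close>.\<close>
definition minimizing_sequence :: "('a \<Rightarrow> real) \<Rightarrow> (nat \<Rightarrow> 'a) \<Rightarrow> bool" where
  "minimizing_sequence f z \<longleftrightarrow> (\<lambda>i. f (z i)) \<longlonglongrightarrow> (INF x. f x)"

definition optimal_solutions :: "('a \<Rightarrow> real) \<Rightarrow> 'a set" where
  "optimal_solutions f = {x. \<forall>y. f x \<le> f y}"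

end

theory Submission
  imports Defs
begin

text \<open>The matrix \<open>Z (Z\<^sup>T Z)\<^sup>\<dagger> Z\<^sup>T\<close> is the orthogonal projection onto the range of \<open>Z\<close>, and
  \<open>owl21 Z\<close> is the sum of the square roots of its diagonal entries. Orthogonal projections form a
  compact set on which this sum is continuous. Hence \<open>owl21\<close> attains its infimum on the singularity
  set, which leaves a gap above \<open>sqrt (r s)\<close>; and on the matrices of rank at least \<open>r\<close> whose \<open>owl21\<close>
  stays inside the gap, \<open>Z \<mapsto> A Z\<close> is bounded below by a multiple of the norm. Since \<open>s < spark A\<close>, the
  matrix \<open>A X\<close> has rank \<open>r\<close>, so for small \<open>\<alpha>\<close> a \<open>Z\<close> whose objective is close to that of \<open>X\<close> has rank at
  least \<open>r\<close>. Sublevel sets slightly above the value at \<open>X\<close> are therefore bounded.\<close>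

subsection \<open>Orthogonal projections and the pseudo-inverse\<close>

lemma matrix_diff_ldistrib: "(A :: real^'n^'m) ** (B - C) = A ** B - A ** C"
  by (simp add: vec_eq_iff matrix_matrix_mult_def right_diff_distrib sum_subtractf)

lemma matrix_diff_rdistrib: "(B - C) ** (A :: real^'n^'m) = B ** A - C ** A"
  by (simp add: vec_eq_iff matrix_matrix_mult_def left_diff_distrib sum_subtractf)

lemma matrix_add_rdistrib: "(B + C) ** (A :: real^'n^'m) = B ** A + C ** A"
  by (simp add: vec_eq_iff matrix_matrix_mult_def distrib_right sum.distrib)

lemma matrix_mult_scaleR_right: "(A :: real^'n^'m) ** (c *\<^sub>R B) = c *\<^sub>R (A ** B)"
  by (simp add: vec_eq_iff matrix_matrix_mult_def sum_distrib_left mult_ac)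

text \<open>Multiplying by \<open>transpose W\<close> turns the hypothesis into the vanishing of the
  Gram matrix of \<open>Z ** W\<close>, whose diagonal holds the squared column norms. This allows
  \<open>transpose Z\<close> to be cancelled on the left.\<close>

lemma gram_mult_eq_0:
  fixes Z :: "real^'k^'n" and W :: "real^'l^'k"
  assumes "transpose Z ** Z ** W = 0"
  shows "Z ** W = 0"
proof -
  have "transpose (Z ** W) ** (Z ** W) = transpose W ** (transpose Z ** Z ** W)"
    by (simp add: matrix_transpose_mul matrix_mul_assoc)
  hence "transpose (Z ** W) ** (Z ** W) = 0"
    using assms by simp
  hence "column j (Z ** W) \<bullet> column j (Z ** W) = 0" for j
    unfolding matrix_mult_transpose_dot_column
    by (metis (no_types, lifting) vec_lambda_beta zero_index)
  hence "column j (Z ** W) = 0" for j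
    by simp
  thus ?thesis
    by (simp add: vec_eq_iff column_def)
qed

definition orth_projection :: "real^'n^'n \<Rightarrow> bool" where
  "orth_projection P \<longleftrightarrow> P ** P = P \<and> transpose P = P"

lemma orth_projection_range_iff:
  assumes "orth_projection P"
  shows "x \<in> range ((*v) P) \<longleftrightarrow> P *v x = x"
proof -
  have "P *v (P *v y) = P *v y" for y
    using assms by (simp add: orth_projection_def matrix_vector_mul_assoc)
  thus ?thesis
    by (auto intro: sym range_eqI[of _ _ x])
qed

lemma orth_projection_range_subset:
  assumes "orth_projection P" "range ((*v) Q) \<subseteq> range ((*v) P)"
  shows "P ** Q = Q"
proof -
  have "P *v (Q *v x) = Q *v x" for x
    using assms orth_projection_range_iff by blast
  thus ?thesis
    by (simp add: matrix_eq matrix_vector_mul_assoc)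
qed

text \<open>Equal ranges give \<open>P ** Q = Q\<close> and \<open>Q ** P = P\<close>; transposing
  the second equation turns it into \<open>P ** Q = P\<close>.\<close>

lemma orth_projection_unique:
  assumes "orth_projection P" "orth_projection Q" "range ((*v) P) = range ((*v) Q)"
  shows "P = Q"
proof -
  have "P ** Q = Q" "Q ** P = P"
    using assms by (simp_all add: orth_projection_range_subset)
  thus ?thesis
    using assms unfolding orth_projection_def by (metis matrix_transpose_mul)
qed

text \<open>\<open>P\<close> is the sum of the outer products of the vectors of an orthonormal basis
  with themselves. Each of them contributes its squared norm, that is 1, to the trace.\<close>

lemma orth_projection_onto_exists:
  fixes V :: "(real^'n) set"
  assumes "subspace V"
  obtains P where "orth_projection P" "range ((*v) P) = V" "trace P = real (dim V)"
proof -
  obtain B where B: "B \<subseteq> V" "pairwise orthogonal B" "\<And>x. x \<in> B \<Longrightarrow> norm x = 1"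
    "independent B" "card B = dim V" "span B = V"
    using orthonormal_basis_subspace[OF assms] by blast
  have fin: "finite B"
    using B(4) by (rule independent_imp_finite)
  define P :: "real^'n^'n" where "P = (\<chi> i j. \<Sum>b\<in>B. b $ i * b $ j)"
  have Pv: "P *v x = (\<Sum>b\<in>B. (b \<bullet> x) *\<^sub>R b)" for x
    by (simp add: vec_eq_iff P_def matrix_vector_mult_def inner_vec_def sum_distrib_right
        sum_distrib_left mult_ac) (simp add: sum.swap[of _ B])
  have Pb: "P *v b = b" if "b \<in> B" for b
  proof -
    have "(\<Sum>c\<in>B. (c \<bullet> b) *\<^sub>R c) = (\<Sum>c\<in>B. if c = b then b else 0)"
      using B(2,3) that
      by (intro sum.cong) (auto simp: pairwise_def orthogonal_def norm_eq_1)
    thus ?thesis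
      using that fin by (simp add: Pv)
  qed
  have PV: "P *v x = x" if "x \<in> V" for x
  proof -
    have "x \<in> span B" using that B(6) by simp
    thus ?thesis
      by (induction rule: span_induct)
        (auto simp: subspace_def Pb matrix_vector_right_distrib matrix_vector_mult_scaleR)
  qed
  have PR: "P *v x \<in> V" for x
    unfolding Pv using B(1) by (intro subspace_sum subspace_scale assms) auto
  have "P *v (P *v x) = P *v x" for x
    using PV PR by blast
  hence "P ** P = P"
    by (simp add: matrix_eq matrix_vector_mul_assoc)
  moreover have "transpose P = P"
    by (simp add: transpose_def P_def vec_eq_iff mult.commute)
  moreover have "range ((*v) P) = V"
    using PV PR by (metis image_subset_iff rangeI subsetI subset_antisym)
  moreover have "trace P = real (dim V)"
  proof -
    have "trace P = (\<Sum>b\<in>B. b \<bullet> b)"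
      by (simp add: trace_def P_def inner_vec_def sum.swap[of _ B])
    also have "\<dots> = (\<Sum>b\<in>B. 1)"
      using B(3) by (intro sum.cong) (auto simp: norm_eq_1)
    finally show ?thesis
      using B(5) by simp
  qed
  ultimately show thesis
    using that unfolding orth_projection_def by blast
qed

lemma subspace_range_matrix: "subspace (range ((*v) (A :: real^'n^'m)))"
  by (intro linear_subspace_image) auto

text \<open>This replaces the rank by a continuous function, so that rank bounds become closed
  conditions on projections.\<close>

lemma trace_orth_projection:
  assumes "orth_projection (P :: real^'n^'n)"
  shows "trace P = real (rank P)"
proof -
  obtain Q where "orth_projection Q" "range ((*v) Q) = range ((*v) P)"
    "trace Q = real (dim (range ((*v) P)))"
    using orth_projection_onto_exists[OF subspace_range_matrix] by blast
  thus ?thesis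
    using assms orth_projection_unique rank_dim_range by metis
qed

section \<open>The pseudo-inverse: uniqueness, and existence for symmetric matrices\<close>

lemma is_pinv_unique:
  assumes "is_pinv A B" "is_pinv A C"
  shows "B = C"
proof -
  note p = assms[unfolded is_pinv_def]
  \<comment> \<open>\<open>A ** C\<close> fixes \<open>A\<close>, and both products are symmetric,
    so transposing reverses their order and exchanges their roles. The products
    \<open>B ** A\<close> and \<open>C ** A\<close> are treated in the same way.\<close>
  have "A ** B = transpose (A ** C ** (A ** B))"
    using p by (simp add: matrix_mul_assoc)
  also have "\<dots> = transpose (A ** B) ** transpose (A ** C)"
    by (rule matrix_transpose_mul)
  also have "\<dots> = A ** B ** A ** C"
    using p by (simp add: matrix_mul_assoc)
  finally have AB: "A ** B = A ** C"
    using p by simp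
  have "B ** A = transpose (B ** A ** (C ** A))"
    using p by (metis matrix_mul_assoc)
  also have "\<dots> = transpose (C ** A) ** transpose (B ** A)"
    by (rule matrix_transpose_mul)
  also have "\<dots> = C ** A ** (B ** A)"
    using p by simp
  also have "\<dots> = C ** (A ** B ** A)"
    by (simp only: matrix_mul_assoc)
  finally have BA: "B ** A = C ** A"
    using p by simp
  have "B = B ** (A ** B)"
    using p by (simp add: matrix_mul_assoc)
  also have "\<dots> = B ** A ** C"
    unfolding AB by (simp add: matrix_mul_assoc)
  also have "\<dots> = C ** A ** C"
    unfolding BA ..
  finally show ?thesis
    using p by simp
qed

text \<open>With \<open>Q\<close> the orthogonal projection onto the range of a symmetric \<open>G\<close>, the matrix \<open>G + (1 - Q)\<close> is
  invertible and commutes with \<open>Q\<close>; its inverse times \<open>Q\<close> is the pseudo-inverse.\<close>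
lemma is_pinv_exists_symmetric:
  fixes G :: "real^'n^'n"
  assumes sym: "transpose G = G"
  shows "\<exists>B. is_pinv G B"
proof -
  obtain Q where Q: "orth_projection Q" "range ((*v) Q) = range ((*v) G)"
    using orth_projection_onto_exists[OF subspace_range_matrix] by blast
  have QQ: "Q ** Q = Q" and Qt: "transpose Q = Q"
    using Q(1) by (auto simp: orth_projection_def)
  have QG: "Q ** G = G"
    using Q by (simp add: orth_projection_range_subset)
  have GQ: "G ** Q = G"
    using QG sym Qt by (metis matrix_transpose_mul)
  define H where "H = G + (mat 1 - Q)"
  have HQ: "H ** Q = G"
    by (simp add: H_def matrix_add_rdistrib matrix_diff_rdistrib GQ QQ)
  have QH: "Q ** H = G"
    by (simp add: H_def matrix_add_ldistrib matrix_diff_ldistrib QG QQ)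
  have "x = 0" if "H *v x = 0" for x
  proof -
    have "G *v x = Q *v (H *v x)"
      by (simp add: matrix_vector_mul_assoc QH)
    hence Gx: "G *v x = 0"
      using that by simp
    hence "x = Q *v x"
      using that by (simp add: H_def matrix_vector_mult_add_rdistrib matrix_vector_mult_diff_rdistrib)
    then obtain y where y: "x = G *v y"
      using Q(2) by (metis rangeE rangeI)
    \<comment> \<open>The range of a symmetric matrix is orthogonal to its kernel, and
      \<open>x\<close> lies in both.\<close>
    have "x \<bullet> x = y \<bullet> (G *v x)"
      using dot_lmul_matrix[of y G x] transpose_matrix_vector[of G y] sym y by simp
    thus ?thesis
      using Gx by simp
  qed
  then obtain K where KH: "K ** H = mat 1"
    using matrix_left_invertible_ker[of H] by blast
  hence HK: "H ** K = mat 1"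
    by (simp add: matrix_left_right_inverse)
  have KG: "K ** G = Q"
    using matrix_mul_assoc[of K H Q] by (simp add: HQ KH)
  have GK: "G ** K = Q"
    using matrix_mul_assoc[of Q H K] by (simp add: QH HK)
  have BG: "K ** Q ** G = Q"
    using matrix_mul_assoc[of K Q G] by (simp add: QG KG)
  have GB: "G ** (K ** Q) = Q"
    by (simp add: matrix_mul_assoc GK QQ)
  have QB: "Q ** (K ** Q) = K ** Q"
    using matrix_mul_assoc[of K G "K ** Q"] matrix_mul_assoc[of "K ** Q" G K]
    by (simp add: matrix_mul_assoc KG GK BG QQ)
  have "is_pinv G (K ** Q)"
    unfolding is_pinv_def
  proof (intro conjI)
    show "G ** (K ** Q) ** G = G"
      by (simp add: GB QG)
    show "K ** Q ** G ** (K ** Q) = K ** Q"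
      by (simp add: BG QB)
  qed (simp_all add: GB BG Qt)
  thus ?thesis ..
qed

lemma is_pinv_transpose: "is_pinv A B \<Longrightarrow> is_pinv (transpose A) (transpose B)"
  unfolding is_pinv_def by (metis matrix_mul_assoc matrix_transpose_mul)

text \<open>Transposition preserves the Penrose equations, so uniqueness carries the symmetry of
  \<open>G\<close> over to \<open>pinv G\<close>. The Gram matrix \<open>transpose Z ** Z\<close> is
  the case of interest.\<close>

lemma
  fixes G :: "real^'n^'n"
  assumes "transpose G = G"
  shows is_pinv_pinv_symmetric: "is_pinv G (pinv G)"
    and transpose_pinv_symmetric: "transpose (pinv G) = pinv G"
proof -
  show *: "is_pinv G (pinv G)"
    unfolding pinv_def using is_pinv_exists_symmetric[OF assms] is_pinv_unique by (blast intro: theI')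
  show "transpose (pinv G) = pinv G"
    by (rule is_pinv_unique[OF is_pinv_transpose[OF *, unfolded assms] *])
qed

section \<open>The orthogonal projection onto the range of a matrix\<close>

definition range_projection :: "real^'k^'n \<Rightarrow> real^'n^'n" where
  "range_projection Z = Z ** pinv (transpose Z ** Z) ** transpose Z"

text \<open>For the Gram matrix \<open>G\<close>, the first Penrose equation says that
  \<open>G\<close> annihilates \<open>pinv G ** G - mat 1\<close>; by \<open>gram_mult_eq_0\<close>,
  so does \<open>Z\<close>.\<close>

lemma range_projection_mult: "range_projection Z ** Z = Z"
proof -
  let ?G = "transpose Z ** Z"
  have "?G ** pinv ?G ** ?G = ?G"
    using is_pinv_pinv_symmetric[of ?G] by (simp add: is_pinv_def matrix_transpose_mul)
  hence "?G ** (pinv ?G ** ?G - mat 1) = 0"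
    by (simp add: matrix_diff_ldistrib matrix_mul_assoc)
  hence "Z ** (pinv ?G ** ?G - mat 1) = 0"
    by (rule gram_mult_eq_0)
  thus ?thesis
    by (simp add: range_projection_def matrix_diff_ldistrib matrix_mul_assoc)
qed

lemma orth_projection_range_projection: "orth_projection (range_projection Z)"
proof -
  let ?G = "transpose Z ** Z"
  have G: "transpose ?G = ?G"
    by (simp add: matrix_transpose_mul)
  have "range_projection Z ** range_projection Z
      = (range_projection Z ** Z) ** pinv ?G ** transpose Z"
    by (simp add: range_projection_def matrix_mul_assoc)
  also have "\<dots> = range_projection Z"
    unfolding range_projection_mult by (simp add: range_projection_def)
  finally show ?thesis
    using transpose_pinv_symmetric[OF G]
    by (simp add: orth_projection_def) (simp add: range_projection_def matrix_transpose_mul matrix_mul_assoc)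
qed

lemma range_matrix_mult_subset:
  "range ((*v) (A ** B :: real^'n^'m)) \<subseteq> range ((*v) (A :: real^'l^'m))"
  by (auto simp flip: matrix_vector_mul_assoc)

lemma range_range_projection: "range ((*v) (range_projection Z)) = range ((*v) Z)"
proof
  show "range ((*v) (range_projection Z)) \<subseteq> range ((*v) Z)"
    unfolding range_projection_def
    using range_matrix_mult_subset by (metis matrix_mul_assoc)
  show "range ((*v) Z) \<subseteq> range ((*v) (range_projection Z))"
    using range_matrix_mult_subset range_projection_mult by metis
qed

lemma range_projection_eqI:
  assumes "orth_projection P" "range ((*v) P) = range ((*v) Z)"
  shows "range_projection Z = P"
  by (rule orth_projection_unique[OF orth_projection_range_projection assms(1)])
    (simp add: assms(2) range_range_projection)

lemma trace_range_projection: "trace (range_projection Z) = real (rank Z)"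
  by (simp add: trace_orth_projection orth_projection_range_projection rank_dim_range
      range_range_projection)

section \<open>The functional \<open>owl21\<close> in terms of projections\<close>

definition diag_sqrt_sum :: "real^'n^'n \<Rightarrow> real" where
  "diag_sqrt_sum P = (\<Sum>n\<in>UNIV. sqrt (P $ n $ n))"

lemma owl21_eq: "owl21 Z = diag_sqrt_sum (range_projection Z)"
proof -
  have "range_projection Z $ n $ n = row n Z \<bullet> (pinv (transpose Z ** Z) *v row n Z)" for n
    unfolding range_projection_def matrix_mul_assoc[symmetric]
    by (simp add: matrix_matrix_mult_def[of Z] matrix_matrix_mult_def[of "pinv _"] inner_vec_def
        matrix_vector_mult_def row_def transpose_def)
  thus ?thesis
    by (simp add: owl21_def diag_sqrt_sum_def)
qed

lemma orth_projection_diag: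
  assumes "orth_projection P"
  shows "P $ n $ n = (norm (P $ n))\<^sup>2"
proof -
  have "P $ n $ n = (P ** transpose P) $ n $ n"
    using assms by (simp add: orth_projection_def)
  also have "\<dots> = P $ n \<bullet> P $ n"
    by (simp add: matrix_matrix_mult_def transpose_def inner_vec_def)
  finally show ?thesis
    by (simp add: power2_norm_eq_inner)
qed

lemma orth_projection_diag_nonneg: "orth_projection P \<Longrightarrow> 0 \<le> P $ n $ n"
  by (simp add: orth_projection_diag)

text \<open>The squared norm of a row is its own diagonal entry, hence at most the norm of that row.
  This makes the set of orthogonal projections bounded.\<close>

lemma orth_projection_norm_row_le_1:
  assumes "orth_projection P"
  shows "norm (P $ n) \<le> 1"
proof -
  have "(norm (P $ n))\<^sup>2 \<le> norm (P $ n)"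
    using orth_projection_diag[OF assms, of n] component_le_norm_cart[of "P $ n" n] by linarith
  thus ?thesis
    by (cases "norm (P $ n) = 0") (auto simp: power2_eq_square)
qed

lemma norm_orth_projection_le:
  assumes "orth_projection P"
  shows "norm (P *v x) \<le> norm x"
proof -
  have "(norm (P *v x))\<^sup>2 = x \<bullet> (P *v x)"
    using assms dot_lmul_matrix[of x P "P *v x"] transpose_matrix_vector[of P x]
    by (simp add: orth_projection_def power2_norm_eq_inner matrix_vector_mul_assoc)
  also have "\<dots> \<le> norm x * norm (P *v x)"
    by (rule norm_cauchy_schwarz)
  finally show ?thesis
    by (cases "norm (P *v x) = 0") (auto simp: power2_eq_square)
qed

text \<open>The hypothesis \<open>Q ** P = P\<close> means that the range of \<open>P\<close> is
  contained in that of \<open>Q\<close>. By symmetry the rows of \<open>P\<close> are then the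
  images under \<open>P\<close> of the rows of \<open>Q\<close>, and \<open>P\<close> does not
  increase norms.\<close>

lemma diag_sqrt_sum_mono:
  assumes P: "orth_projection P" and Q: "orth_projection Q" and QP: "Q ** P = P"
  shows "diag_sqrt_sum P \<le> diag_sqrt_sum Q"
  unfolding diag_sqrt_sum_def
proof (intro sum_mono real_sqrt_le_mono)
  fix n
  have PQ: "P ** Q = P"
    using P Q QP unfolding orth_projection_def by (metis matrix_transpose_mul)
  have r: "P $ n = P *v Q $ n"
  proof -
    have "transpose (P ** Q) $ n = P *v Q $ n"
      using Q P by (simp add: vec_eq_iff transpose_def matrix_matrix_mult_def matrix_vector_mult_def
          orth_projection_def mult.commute)
    thus ?thesis using P PQ by (simp add: orth_projection_def)
  qed
  show "P $ n $ n \<le> Q $ n $ n"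
    unfolding orth_projection_diag[OF P] orth_projection_diag[OF Q]
    by (subst r) (intro power_mono norm_orth_projection_le P norm_ge_zero)
qed

text \<open>Among the orthogonal projections that fix \<open>Z\<close>, the range projection has the
  smallest range. The bound takes the place of lower semicontinuity of \<open>owl21\<close>, since a
  limit of range projections still fixes the limit matrix.\<close>

lemma owl21_le_diag_sqrt_sum:
  assumes "orth_projection P" "P ** Z = Z"
  shows "owl21 Z \<le> diag_sqrt_sum P"
  unfolding owl21_eq
proof (intro diag_sqrt_sum_mono assms orth_projection_range_projection)
  show "P ** range_projection Z = range_projection Z"
    by (simp add: range_projection_def matrix_mul_assoc assms(2))
qed

lemma owl21_nonneg: "0 \<le> owl21 Z"
  unfolding owl21_eq diag_sqrt_sum_def
  by (simp add: sum_nonneg orth_projection_diag_nonneg orth_projection_range_projection)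

text \<open>The squared row norms of the projection vanish off the \<open>s\<close> nonzero rows and sum up to the rank,
  so this is Cauchy--Schwarz.\<close>
lemma owl21_le_sqrt_rank_card_rows:
  fixes X :: "real^'k^'n"
  shows "owl21 X \<le> sqrt (real (rank X) * real (card {n. row n X \<noteq> 0}))"
proof -
  let ?P = "range_projection X" and ?S = "{n. row n X \<noteq> 0}"
  have P: "orth_projection ?P"
    by (rule orth_projection_range_projection)
  have z: "?P $ n $ n = 0" if "n \<notin> ?S" for n
  proof -
    have "X $ n = 0"
      using that by (simp add: row_def vec_eq_iff)
    thus ?thesis
      unfolding range_projection_def matrix_mul_assoc[symmetric]
      by (simp add: matrix_matrix_mult_def)
  qed
  have "owl21 X = (\<Sum>n\<in>?S. sqrt (?P $ n $ n) * 1)"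
    unfolding owl21_eq diag_sqrt_sum_def using z by (intro sum.mono_neutral_cong_right) auto
  also have "\<dots> \<le> L2_set (\<lambda>n. sqrt (?P $ n $ n)) ?S * L2_set (\<lambda>_. 1) ?S"
    by (rule order_trans[OF _ L2_set_mult_ineq]) (auto intro!: sum_mono)
  also have "L2_set (\<lambda>n. sqrt (?P $ n $ n)) ?S = sqrt (trace ?P)"
    unfolding L2_set_def trace_def using z
    by (simp add: orth_projection_diag_nonneg P) (intro sum.mono_neutral_left, auto)
  also have "L2_set (\<lambda>_. 1::real) ?S = sqrt (real (card ?S))"
    by (simp add: L2_set_def)
  finally show ?thesis
    by (simp add: trace_range_projection real_sqrt_mult)
qed

subsection \<open>Compactness and the singularity set\<close>

text \<open>The rank of \<open>A ** Z\<close> is the dimension of the image under \<open>A\<close>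
  of the range of \<open>Z\<close>; it drops exactly when \<open>A\<close> is not injective on that
  range.\<close>

lemma rank_mult_less_iff:
  fixes A :: "real^'n^'m" and Z :: "real^'k^'n"
  shows "rank (A ** Z) < rank Z \<longleftrightarrow> (\<exists>w\<in>range ((*v) Z). w \<noteq> 0 \<and> A *v w = 0)"
proof -
  let ?V = "range ((*v) Z)"
  have V: "subspace ?V"
    by (rule subspace_range_matrix)
  have r: "rank (A ** Z) = dim ((*v) A ` ?V)"
    by (simp add: rank_dim_range image_image matrix_vector_mul_assoc)
  have "dim ((*v) A ` ?V) = dim ?V" if *: "\<not> (\<exists>w\<in>?V. w \<noteq> 0 \<and> A *v w = 0)"
  proof (rule dim_image_eq)
    have "x = y" if "x \<in> ?V" "y \<in> ?V" "A *v x = A *v y" for x y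
    proof -
      have "x - y \<in> ?V" "A *v (x - y) = 0"
        using that V by (simp_all add: subspace_diff matrix_vector_mult_diff_distrib)
      thus ?thesis using * by (metis eq_iff_diff_eq_0)
    qed
    moreover have "span ?V = ?V"
      using V by (rule span_eq_iff[THEN iffD2])
    ultimately show "inj_on ((*v) A) (span ?V)"
      by (metis inj_onI)
  qed auto
  moreover have "dim ((*v) A ` ?V) < dim ?V" if w: "w \<in> ?V" "w \<noteq> 0" "A *v w = 0" for w
  proof -
    \<comment> \<open>A basis of \<open>?V\<close> containing the kernel vector \<open>w\<close>
      loses that vector under \<open>A\<close>, so the image is spanned by fewer vectors.\<close>
    obtain B where B: "{w} \<subseteq> B" "B \<subseteq> ?V" "independent B" "?V \<subseteq> span B"
      using maximal_independent_subset_extend[of "{w}" ?V] w by auto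
    have fin: "finite B"
      using B(3) by (rule independent_imp_finite)
    have "(*v) A ` ?V \<subseteq> (*v) A ` span B"
      using B by blast
    also have "\<dots> = span ((*v) A ` B)"
      by (simp add: linear_span_image)
    also have "(*v) A ` B = insert 0 ((*v) A ` (B - {w}))"
      using B(1) w(3) by force
    finally have "dim ((*v) A ` ?V) \<le> card ((*v) A ` (B - {w}))"
      using fin by (intro dim_le_card) (simp_all add: span_insert_0)
    also have "\<dots> \<le> card (B - {w})"
      using fin by (intro card_image_le) simp
    also have "\<dots> < card B"
      using fin B(1) by (intro psubset_card_mono) auto
    also have "card B = dim ?V"
      using B by (intro basis_card_eq_dim) auto
    finally show ?thesis .
  qed
  ultimately show ?thesis
    unfolding r rank_dim_range[of Z] by (metis less_irrefl)
qed

lemma continuous_on_matrix_mult [continuous_intros]: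
  fixes f :: "'a::topological_space \<Rightarrow> real^'n^'m" and g :: "'a \<Rightarrow> real^'k^'n"
  assumes "continuous_on S f" "continuous_on S g"
  shows "continuous_on S (\<lambda>x. f x ** g x)"
  unfolding matrix_matrix_mult_def
  by (intro continuous_intros assms)

lemma continuous_on_transpose [continuous_intros]:
  fixes f :: "'a::topological_space \<Rightarrow> real^'n^'m"
  assumes "continuous_on S f"
  shows "continuous_on S (\<lambda>x. transpose (f x))"
  unfolding transpose_def by (intro continuous_intros assms)

lemma continuous_on_trace [continuous_intros]:
  fixes f :: "'a::topological_space \<Rightarrow> real^'n^'n"
  assumes "continuous_on S f"
  shows "continuous_on S (\<lambda>x. trace (f x))"
  unfolding trace_def by (intro continuous_intros assms)

lemma continuous_on_diag_sqrt_sum [continuous_intros]: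
  assumes "continuous_on S f"
  shows "continuous_on S (\<lambda>x. diag_sqrt_sum (f x))"
  unfolding diag_sqrt_sum_def by (intro continuous_intros assms)

text \<open>\<open>P\<close> is a separate component, only required to fix \<open>W\<close>: the
  range projection of \<open>W\<close> is not continuous in \<open>W\<close>, whereas
  \<open>P ** W = W\<close> is a closed condition.\<close>

definition projection_pairs :: "real \<Rightarrow> ((real^'n^'n) \<times> (real^'k^'n)) set" where
  "projection_pairs R = {(P, W). orth_projection P \<and> P ** W = W \<and> norm W \<le> R}"

lemma compact_projection_pairs:
  "compact (projection_pairs R :: ((real^'n^'n) \<times> (real^'k^'n)) set)"
proof -
  have eq: "projection_pairs R = {p :: (real^'n^'n) \<times> (real^'k^'n). fst p ** fst p = fst p}
      \<inter> {p. transpose (fst p) = fst p} \<inter> {p. fst p ** snd p = snd p} \<inter> {p. norm (snd p) \<le> R}"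
    by (auto simp: projection_pairs_def orth_projection_def)
  have "closed (projection_pairs R :: ((real^'n^'n) \<times> (real^'k^'n)) set)"
    unfolding eq by (intro closed_Int closed_Collect_eq closed_Collect_le continuous_intros)
  moreover have "bounded (projection_pairs R :: ((real^'n^'n) \<times> (real^'k^'n)) set)"
  proof (rule bounded_subset)
    show "bounded (cball (0 :: real^'n^'n) (real CARD('n)) \<times> cball (0 :: real^'k^'n) R)"
      by (intro bounded_Times bounded_cball)
    have "norm P \<le> real CARD('n)" if "orth_projection P" for P :: "real^'n^'n"
    proof -
      have "norm P \<le> (\<Sum>i\<in>UNIV. norm (P $ i))"
        unfolding norm_vec_def[of P] by (intro L2_set_le_sum) simp
      also have "\<dots> \<le> (\<Sum>i\<in>(UNIV :: 'n set). 1)"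
        by (intro sum_mono orth_projection_norm_row_le_1 that)
      finally show ?thesis by simp
    qed
    thus "projection_pairs R \<subseteq> cball (0 :: real^'n^'n) (real CARD('n)) \<times> cball (0 :: real^'k^'n) R"
      by (auto simp: projection_pairs_def)
  qed
  ultimately show ?thesis
    by (simp add: compact_eq_bounded_closed)
qed

text \<open>The vectors of a basis of the range of \<open>P\<close> are placed in distinct columns
  of \<open>Z\<close>; the rank bound ensures that there are enough columns.\<close>

lemma orth_projection_eq_range_projection:
  fixes P :: "real^'n^'n"
  assumes P: "orth_projection P" and le: "rank P \<le> CARD('k)"
  obtains Z :: "real^'k^'n" where "range_projection Z = P"
proof -
  obtain B where B: "B \<subseteq> range ((*v) P)" "independent B" "span B = range ((*v) P)" "card B = rank P"
    using basis_exists[of "range ((*v) P)"] span_eq_iff subspace_range_matrix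
    by (metis rank_dim_range span_minimal subset_antisym)
  have fin: "finite B"
    using B(2) by (rule independent_imp_finite)
  obtain h :: "(real^'n) \<Rightarrow> 'k" where h: "inj_on h B"
    using card_le_inj[OF fin finite_class.finite_UNIV] le B(4) by metis
  \<comment> \<open>Columns that receive no basis vector are zero and do not change the
    span.\<close>
  define c where "c = (\<lambda>j. if j \<in> h ` B then the_inv_into B h j else 0)"
  define Z :: "real^'k^'n" where "Z = (\<chi> i j. c j $ i)"
  have col: "column j Z = c j" for j
    by (simp add: Z_def column_def vec_eq_iff)
  have "range ((*v) Z) = span (columns Z)"
  proof
    show "range ((*v) Z) \<subseteq> span (columns Z)"
      using matrix_vector_mult_in_columnspace by blast
    show "span (columns Z) \<subseteq> range ((*v) Z)"
      by (intro span_minimal subspace_range_matrix) (auto simp: columns_image_basis)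
  qed
  also have "span (columns Z) = span B"
  proof (intro antisym span_minimal subspace_span subsetI)
    fix x assume "x \<in> columns Z"
    then obtain j where "x = c j"
      by (auto simp: columns_def col)
    thus "x \<in> span B"
      using h by (auto simp: c_def the_inv_into_f_f span_base span_zero)
  next
    fix b assume "b \<in> B"
    hence "b = column (h b) Z"
      using h by (simp add: col c_def the_inv_into_f_f)
    thus "b \<in> span (columns Z)"
      by (auto simp: columns_def intro: span_base)
  qed
  finally have "range_projection Z = P"
    using P B(3) by (intro range_projection_eqI) auto
  thus thesis ..
qed

lemma singularity_set_imp_pair:
  fixes Z :: "real^'k^'n"
  assumes "Z \<in> singularity_set r A"
  obtains W :: "real^'k^'n" where "norm W = 1" "range_projection Z ** W = W" "A ** W = 0"
proof -
  obtain w where w: "w \<in> range ((*v) Z)" "w \<noteq> 0" "A *v w = 0"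
    using assms rank_mult_less_iff[of A Z] by (auto simp: singularity_set_def)
  \<comment> \<open>Every column of \<open>V\<close> is \<open>w\<close>, which gives the kernel
    vector the matrix type of \<open>Z\<close>; normalising \<open>V\<close> yields
    \<open>W\<close>.\<close>
  define V :: "real^'k^'n" where "V = (\<chi> i j. w $ i)"
  have mult: "C ** V = (\<chi> i j. (C *v w) $ i)" for C :: "real^'n^'l"
    by (simp add: V_def vec_eq_iff matrix_matrix_mult_def matrix_vector_mult_def)
  have "range_projection Z *v w = w"
    using w(1) orth_projection_range_iff[OF orth_projection_range_projection]
    by (metis range_range_projection)
  hence "range_projection Z ** V = V"
    by (simp add: mult) (simp add: V_def)
  moreover have "A ** V = 0"
    by (simp add: mult w(3) vec_eq_iff)
  moreover have "V \<noteq> 0"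
    using w(2) by (simp add: V_def vec_eq_iff)
  ultimately show thesis
    by (intro that[of "(1 / norm V) *\<^sub>R V"]) (simp_all add: matrix_mult_scaleR_right)
qed

text \<open>Membership depends only on the range of \<open>Z\<close>, so any \<open>Z\<close> with
  range projection \<open>P\<close> serves: a nonzero vector \<open>W *v x\<close> lies in that
  range and is annihilated by \<open>A\<close>. The trace bounds are rank bounds.\<close>

lemma pair_imp_singularity_set:
  fixes W :: "real^'k^'n"
  assumes P: "orth_projection P" and r: "real r \<le> trace P" and le: "trace P \<le> real CARD('k)"
    and W: "P ** W = W" "W \<noteq> 0" "A ** W = 0"
  obtains Z :: "real^'k^'n" where "Z \<in> singularity_set r A" "range_projection Z = P"
proof -
  have "rank P \<le> CARD('k)"
    using le trace_orth_projection[OF P] by simp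
  then obtain Z :: "real^'k^'n" where Z: "range_projection Z = P"
    using orth_projection_eq_range_projection[OF P] by blast
  obtain x where x: "W *v x \<noteq> 0"
    using W(2) by (metis matrix_eq matrix_vector_mult_0)
  have "P *v (W *v x) = W *v x"
    by (simp add: matrix_vector_mul_assoc W(1))
  hence "W *v x \<in> range ((*v) Z)"
    using Z range_range_projection by (metis rangeI)
  moreover have "A *v (W *v x) = 0"
    by (simp add: matrix_vector_mul_assoc W(3))
  ultimately have "rank (A ** Z) < rank Z"
    using x rank_mult_less_iff by blast
  moreover have "r \<le> rank Z"
    using r trace_range_projection[of Z] by (simp add: Z)
  ultimately show thesis
    using that Z by (auto simp: singularity_set_def)
qed

text \<open>The normalisation of \<open>W\<close> keeps it from degenerating to zero in a limit, and
  the trace bounds encode \<open>r \<le> rank P \<le> CARD('k)\<close> by closed conditions.\<close>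

definition unit_projection_pairs :: "nat \<Rightarrow> ((real^'n^'n) \<times> (real^'k^'n)) set" where
  "unit_projection_pairs r = projection_pairs 1 \<inter>
     {(P, W). real r \<le> trace P \<and> trace P \<le> real CARD('k) \<and> norm W = 1}"

lemma compact_unit_projection_pairs:
  "compact (unit_projection_pairs r :: ((real^'n^'n) \<times> (real^'k^'n)) set)"
proof -
  have eq: "{(P, W). real r \<le> trace P \<and> trace P \<le> real CARD('k) \<and> norm W = 1} =
    {p :: (real^'n^'n) \<times> (real^'k^'n). real r \<le> trace (fst p)} \<inter> {p. trace (fst p) \<le> real CARD('k)}
      \<inter> {p. norm (snd p) = 1}"
    by auto
  show ?thesis
    unfolding unit_projection_pairs_def eq
    by (intro compact_Int_closed compact_projection_pairs closed_Int closed_Collect_eq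
        closed_Collect_le continuous_intros)
qed

lemma range_projection_unit_pair:
  fixes Z W :: "real^'k^'n"
  assumes "r \<le> rank Z" "norm W = 1" "range_projection Z ** W = W"
  shows "(range_projection Z, W) \<in> unit_projection_pairs r"
  using assms rank_bound[of Z]
  by (simp add: unit_projection_pairs_def projection_pairs_def orth_projection_range_projection
      trace_range_projection)

text \<open>The pairs with \<open>A ** W = 0\<close> form a compact set on which
  \<open>diag_sqrt_sum\<close> has a minimiser; its projection is the range projection of a singular
  matrix.\<close>

lemma owl21_attains_inf_singularity_set:
  fixes A :: "real^'n^'m"
  assumes "(singularity_set r A :: (real^'k^'n) set) \<noteq> {}"
  obtains Z0 :: "real^'k^'n" where "Z0 \<in> singularity_set r A"
    "\<And>Z :: real^'k^'n. Z \<in> singularity_set r A \<Longrightarrow> owl21 Z0 \<le> owl21 Z"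
proof -
  define S where "S = unit_projection_pairs r \<inter> {p :: (real^'n^'n) \<times> (real^'k^'n). A ** snd p = 0}"
  have "compact S"
    unfolding S_def
    by (intro compact_Int_closed compact_unit_projection_pairs closed_Collect_eq continuous_intros)
  moreover have in_S: "\<exists>W. (range_projection Z, W) \<in> S"
    if Z: "Z \<in> singularity_set r A" for Z :: "real^'k^'n"
  proof -
    obtain W :: "real^'k^'n" where "norm W = 1" "range_projection Z ** W = W" "A ** W = 0"
      using singularity_set_imp_pair[OF Z] by blast
    moreover have "r \<le> rank Z"
      using Z by (simp add: singularity_set_def)
    ultimately show ?thesis
      using range_projection_unit_pair by (auto simp: S_def)
  qed
  moreover have "S \<noteq> {}"
    using in_S assms by blast
  ultimately obtain P W where PW: "(P, W) \<in> S"
    and min: "\<And>p. p \<in> S \<Longrightarrow> diag_sqrt_sum P \<le> diag_sqrt_sum (fst p)"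
    using continuous_attains_inf[of S "\<lambda>p. diag_sqrt_sum (fst p)"]
    by (force intro: continuous_on_diag_sqrt_sum continuous_on_fst continuous_on_id)
  have "W \<noteq> 0"
    using PW by (auto simp: S_def unit_projection_pairs_def)
  then obtain Z0 :: "real^'k^'n" where Z0: "Z0 \<in> singularity_set r A" "range_projection Z0 = P"
    using pair_imp_singularity_set[of P r W A] PW
    by (auto simp: S_def unit_projection_pairs_def projection_pairs_def)
  show thesis
  proof (rule that[OF Z0(1)])
    fix Z :: "real^'k^'n" assume "Z \<in> singularity_set r A"
    then obtain W' where "(range_projection Z, W') \<in> S"
      using in_S by blast
    from min[OF this] show "owl21 Z0 \<le> owl21 Z"
      by (simp add: owl21_eq Z0(2))
  qed
qed

text \<open>\<open>\<sigma>\<close> is the minimum of \<open>norm (A ** W)\<close> over the unit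
  pairs with \<open>diag_sqrt_sum P \<le> \<mu>\<close>. If it were zero, \<open>P\<close> would
  come from a singular matrix with \<open>owl21\<close> at most \<open>\<mu>\<close>.\<close>

lemma norm_ge_below_singularity_set:
  fixes A :: "real^'n^'m"
  assumes "\<And>Z :: real^'k^'n. Z \<in> singularity_set r A \<Longrightarrow> \<mu> < owl21 Z"
  obtains \<sigma> where "\<sigma> > 0"
    "\<And>Z :: real^'k^'n. r \<le> rank Z \<Longrightarrow> owl21 Z \<le> \<mu> \<Longrightarrow> \<sigma> * norm Z \<le> norm (A ** Z)"
proof -
  define S where "S = unit_projection_pairs r \<inter> {p :: (real^'n^'n) \<times> (real^'k^'n). diag_sqrt_sum (fst p) \<le> \<mu>}"
  have cpt: "compact S"
    unfolding S_def
    by (intro compact_Int_closed compact_unit_projection_pairs closed_Collect_le continuous_intros)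
  have "\<exists>\<sigma>>0. \<forall>p\<in>S. \<sigma> \<le> norm (A ** snd p)"
  proof (cases "S = {}")
    case True
    \<comment> \<open>Without admissible pairs any positive constant will do.\<close>
    thus ?thesis by (auto intro: exI[of _ 1])
  next
    case False
    then obtain P W where PW: "(P, W) \<in> S"
      and min: "\<And>p. p \<in> S \<Longrightarrow> norm (A ** W) \<le> norm (A ** snd p)"
      using continuous_attains_inf[OF cpt, of "\<lambda>p. norm (A ** snd p)"]
      by (force intro: continuous_on_norm continuous_on_matrix_mult continuous_on_const
          continuous_on_snd continuous_on_id)
    have "A ** W \<noteq> 0"
    proof
      assume "A ** W = 0"
      moreover have "W \<noteq> 0"
        using PW by (auto simp: S_def unit_projection_pairs_def)
      ultimately obtain Z :: "real^'k^'n" where "Z \<in> singularity_set r A" "range_projection Z = P"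
        using pair_imp_singularity_set[of P r W A] PW
        by (auto simp: S_def unit_projection_pairs_def projection_pairs_def)
      thus False
        using assms[of Z] PW by (simp add: owl21_eq S_def)
    qed
    thus ?thesis
      using min by (intro exI[of _ "norm (A ** W)"]) auto
  qed
  then obtain \<sigma> where \<sigma>: "\<sigma> > 0" "\<And>p. p \<in> S \<Longrightarrow> \<sigma> \<le> norm (A ** snd p)"
    by blast
  show thesis
  proof (rule that[OF \<sigma>(1)])
    fix Z :: "real^'k^'n" assume Z: "r \<le> rank Z" "owl21 Z \<le> \<mu>"
    show "\<sigma> * norm Z \<le> norm (A ** Z)"
    proof (cases "Z = 0")
      case False
      let ?W = "(1 / norm Z) *\<^sub>R Z"
      have "range_projection Z ** ?W = ?W"
        by (simp add: matrix_mult_scaleR_right range_projection_mult)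
      hence "(range_projection Z, ?W) \<in> S"
        using Z False range_projection_unit_pair[of r Z ?W] by (simp add: S_def owl21_eq)
      from \<sigma>(2)[OF this] have "\<sigma> \<le> norm (A ** Z) / norm Z"
        by (simp add: matrix_mult_scaleR_right)
      thus ?thesis
        using False by (simp add: field_simps)
    qed simp
  qed
qed

section \<open>The rank under perturbation and under left multiplication by \<open>A\<close>\<close>

lemma norm_matrix_vector_mult_le:
  fixes A :: "real^'n^'m"
  shows "norm (A *v x) \<le> norm A * norm x"
proof -
  have "norm (A *v x) \<le> L2_set (\<lambda>i. norm (A $ i) * norm x) UNIV"
    unfolding norm_vec_def[of "A *v x"]
    by (intro L2_set_mono) (simp_all add: matrix_vector_mul_component Cauchy_Schwarz_ineq2)
  also have "\<dots> = norm A * norm x"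
    by (simp add: norm_vec_def[of A] L2_set_left_distrib)
  finally show ?thesis .
qed

text \<open>\<open>M\<close> is injective on its row space and hence bounded below there by some
  \<open>e\<close>. A perturbation of norm less than \<open>e\<close> remains injective on this
  space, whose dimension is \<open>rank M\<close>.\<close>

lemma rank_lower_semicontinuous:
  fixes M :: "real^'n^'m"
  obtains e where "e > 0" "\<And>B :: real^'n^'m. norm (B - M) < e \<Longrightarrow> rank M \<le> rank B"
proof -
  let ?V = "span (rows M)"
  have "\<exists>e>0. \<forall>x\<in>?V. norm (M *v x) \<ge> e * norm x"
    using nullspace_inter_rowspace[of M]
    by (intro injective_imp_isometric) (auto simp: closed_span)
  then obtain e where e: "e > 0" "\<And>x. x \<in> ?V \<Longrightarrow> e * norm x \<le> norm (M *v x)"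
    by blast
  have "rank M \<le> rank B" if B: "norm (B - M) < e" for B :: "real^'n^'m"
  proof -
    have "x = 0" if x: "x \<in> ?V" "B *v x = 0" for x
    proof (rule ccontr)
      assume "x \<noteq> 0"
      have "e * norm x \<le> norm (M *v x)"
        using e(2) x(1) .
      also have "\<dots> = norm ((B - M) *v x)"
        by (simp add: matrix_vector_mult_diff_rdistrib x(2))
      also have "\<dots> \<le> norm (B - M) * norm x"
        by (rule norm_matrix_vector_mult_le)
      also have "\<dots> < e * norm x"
        using B \<open>x \<noteq> 0\<close> by simp
      finally show False by simp
    qed
    hence "inj_on ((*v) B) ?V"
      by (metis (no_types, lifting) eq_iff_diff_eq_0 inj_onI matrix_vector_mult_diff_distrib span_diff)
    hence "dim ((*v) B ` ?V) = dim ?V"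
      by (intro dim_image_eq) (auto simp: span_span)
    moreover have "dim ((*v) B ` ?V) \<le> dim (range ((*v) B))"
      by (intro dim_subset) auto
    ultimately show ?thesis
      by (simp add: rank_dim_range[of B] row_rank_def[of M])
  qed
  thus thesis using that e(1) by blast
qed

text \<open>A rank drop would yield a nonzero kernel vector of \<open>A\<close> in the range of
  \<open>X\<close>. It is supported on the nonzero rows of \<open>X\<close>, so its entries are the
  coefficients of a dependence among too few columns.\<close>

lemma rank_mult_eq_of_less_spark:
  fixes A :: "real^'n^'m" and X :: "real^'k^'n"
  assumes "enat (card {n. row n X \<noteq> 0}) < spark A"
  shows "rank (A ** X) = rank X"
proof (rule ccontr)
  let ?S = "{n. row n X \<noteq> 0}"
  assume "rank (A ** X) \<noteq> rank X"
  hence "rank (A ** X) < rank X"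
    using rank_mul_le_right[of A X] by simp
  then obtain x where w: "X *v x \<noteq> 0" "A *v (X *v x) = 0"
    unfolding rank_mult_less_iff by auto
  let ?w = "X *v x"
  have z: "?w $ n = 0" if "n \<notin> ?S" for n
  proof -
    have "X $ n = 0"
      using that by (simp add: row_def vec_eq_iff)
    thus ?thesis
      by (simp add: matrix_vector_mul_component)
  qed
  have "(\<Sum>n\<in>?S. ?w $ n *\<^sub>R column n A) = (\<Sum>n\<in>UNIV. ?w $ n *\<^sub>R column n A)"
    using z by (intro sum.mono_neutral_left) auto
  also have "\<dots> = A *v ?w"
    by (simp add: matrix_mult_sum scalar_mult_eq_scaleR)
  finally have "(\<Sum>n\<in>?S. ?w $ n *\<^sub>R column n A) = 0"
    using w(2) by simp
  moreover obtain n where "?w $ n \<noteq> 0"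
    using w(1) by (auto simp: vec_eq_iff)
  moreover from this have "n \<in> ?S"
    using z by blast
  ultimately have "dependent_columns A ?S"
    unfolding dependent_columns_def by blast
  hence "spark A \<le> enat (card ?S)"
    unfolding spark_def by (intro INF_lower) simp
  with assms show False by simp
qed

lemma rank_le_card_nonzero_rows:
  fixes X :: "real^'k^'n"
  shows "rank X \<le> card {n. row n X \<noteq> 0}"
proof -
  let ?S = "{n. row n X \<noteq> 0}"
  have "rank X \<le> card ((\<lambda>n. row n X) ` ?S)"
    unfolding row_rank_def
  proof (rule dim_le_card)
    show "rows X \<subseteq> span ((\<lambda>n. row n X) ` ?S)"
    proof
      fix v assume "v \<in> rows X"
      then obtain n where "v = row n X"
        by (auto simp: rows_def)
      thus "v \<in> span ((\<lambda>n. row n X) ` ?S)"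
        by (cases "row n X = 0") (auto intro: span_base span_zero)
    qed
  qed simp
  also have "\<dots> \<le> card ?S"
    by (intro card_image_le) simp
  finally show ?thesis .
qed

subsection \<open>The regularised problem\<close>

text \<open>A strict bound at every singular \<open>Z\<close> passes to the infimum because the
  infimum is attained. Without singular matrices \<open>iota\<close> is infinite and both sides
  hold.\<close>

lemma spherical_section_iff_iota:
  fixes A :: "real^'n^'m"
  assumes "r \<ge> 1"
  shows "spherical_section TYPE('k::finite) r s A \<longleftrightarrow>
    ereal (real s) < (iota TYPE('k) r A)\<^sup>2 / ereal (real r)"
proof (cases "(singularity_set r A :: (real^'k^'n) set) = {}")
  case True
  thus ?thesis
    by (simp add: spherical_section_def iota_def top_ereal_def power2_eq_square)
next
  case False
  then obtain Z0 :: "real^'k^'n" where Z0: "Z0 \<in> singularity_set r A"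
    "\<And>Z :: real^'k^'n. Z \<in> singularity_set r A \<Longrightarrow> owl21 Z0 \<le> owl21 Z"
    using owl21_attains_inf_singularity_set by blast
  have "iota TYPE('k) r A = ereal (owl21 Z0)"
    unfolding iota_def using Z0 by (intro INF_eqI) auto
  hence "ereal (real s) < (iota TYPE('k) r A)\<^sup>2 / ereal (real r) \<longleftrightarrow> real r * real s < (owl21 Z0)\<^sup>2"
    using assms by (simp add: pos_less_divide_eq mult.commute)
  also have "\<dots> \<longleftrightarrow> sqrt (real r * real s) < owl21 Z0"
    using owl21_nonneg[of Z0] by (metis abs_of_nonneg real_sqrt_abs real_sqrt_less_iff)
  also have "\<dots> \<longleftrightarrow> spherical_section TYPE('k) r s A"
    unfolding spherical_section_def using Z0 by force
  finally show ?thesis ..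
qed

text \<open>Attainment again leaves room for a number strictly between \<open>sqrt (r s)\<close> and
  the minimum; \<open>\<mu>\<close> later serves as the sublevel bound of the objective.\<close>

lemma spherical_section_gap:
  fixes A :: "real^'n^'m"
  assumes "spherical_section TYPE('k::finite) r s A"
  obtains \<mu> where "sqrt (real r * real s) < \<mu>"
    "\<And>Z :: real^'k^'n. Z \<in> singularity_set r A \<Longrightarrow> \<mu> < owl21 Z"
proof (cases "(singularity_set r A :: (real^'k^'n) set) = {}")
  case True
  thus thesis
    using that[of "sqrt (real r * real s) + 1"] by simp
next
  case False
  then obtain Z0 :: "real^'k^'n" where Z0: "Z0 \<in> singularity_set r A"
    "\<And>Z :: real^'k^'n. Z \<in> singularity_set r A \<Longrightarrow> owl21 Z0 \<le> owl21 Z"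
    using owl21_attains_inf_singularity_set by blast
  have "sqrt (real r * real s) < owl21 Z0"
    using assms Z0(1) by (simp add: spherical_section_def)
  then obtain \<mu> where "sqrt (real r * real s) < \<mu>" "\<mu> < owl21 Z0"
    using dense by blast
  thus thesis
    using that Z0(2) by (meson less_le_trans)
qed

lemma objective_nonneg: "\<alpha> > 0 \<Longrightarrow> 0 \<le> objective \<alpha> A Y Z"
  by (simp add: objective_def owl21_nonneg)

text \<open>By \<open>owl21_le_diag_sqrt_sum\<close>, relaxing the range projection of \<open>Z\<close> to any orthogonal projection
  that fixes \<open>Z\<close> does not lower the infimum, and it turns the discontinuous objective into a
  continuous function on a compact set.\<close>
lemma optimal_solutions_nonempty:
  fixes A :: "real^'n^'m" and X :: "real^'k^'n"
  assumes "\<alpha> > 0" and X: "objective \<alpha> A Y X \<le> L"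
    and R: "\<And>Z :: real^'k^'n. objective \<alpha> A Y Z \<le> L \<Longrightarrow> norm Z \<le> R"
  shows "optimal_solutions (objective \<alpha> A Y :: real^'k^'n \<Rightarrow> real) \<noteq> {}"
proof -
  let ?S = "projection_pairs R :: ((real^'n^'n) \<times> (real^'k^'n)) set"
  define h where "h = (\<lambda>p :: (real^'n^'n) \<times> (real^'k^'n).
    diag_sqrt_sum (fst p) + 1 / (2 * \<alpha>) * (norm (A ** snd p - Y))\<^sup>2)"
  have h: "h (range_projection Z, Z) = objective \<alpha> A Y Z" for Z
    by (simp add: h_def objective_def owl21_eq)
  have in_S: "(range_projection Z, Z) \<in> ?S" if "objective \<alpha> A Y Z \<le> L" for Z
    using R[OF that]
    by (simp add: projection_pairs_def orth_projection_range_projection range_projection_mult)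
  have "continuous_on ?S h"
    unfolding h_def by (intro continuous_intros)
  then obtain p where p: "p \<in> ?S" and min: "\<And>q. q \<in> ?S \<Longrightarrow> h p \<le> h q"
    using continuous_attains_inf[OF compact_projection_pairs, of R h] in_S[OF X] by blast
  have le: "objective \<alpha> A Y (snd p) \<le> h p"
    using p owl21_le_diag_sqrt_sum[of "fst p" "snd p"]
    by (auto simp: projection_pairs_def h_def objective_def)
  have "objective \<alpha> A Y (snd p) \<le> objective \<alpha> A Y Z" for Z
  proof (cases "objective \<alpha> A Y Z \<le> L")
    case True
    with le min[OF in_S[OF True]] show ?thesis by (simp add: h)
  next
    \<comment> \<open>Such a \<open>Z\<close> may lie outside the compact set; the comparison goes
      through \<open>X\<close>, whose value is at most \<open>L\<close>.\<close>
    case False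
    with le min[OF in_S[OF X]] X show ?thesis by (simp add: h)
  qed
  thus ?thesis
    unfolding optimal_solutions_def by blast
qed

text \<open>The level \<open>L\<close> exceeds the infimum strictly, so a tail of the sequence lies
  in the bounded sublevel set, and only finitely many terms remain.\<close>

lemma minimizing_sequence_bounded:
  fixes f :: "'a::real_normed_vector \<Rightarrow> real"
  assumes "bdd_below (range f)" "f x < L" "\<And>z. f z \<le> L \<Longrightarrow> norm z \<le> R"
    and "minimizing_sequence f z"
  shows "bounded (range z)"
proof -
  have "(INF x. f x) < L"
    using cINF_lower[OF assms(1), of x] assms(2) by simp
  hence "eventually (\<lambda>i. f (z i) < L) sequentially"
    using assms(4) unfolding minimizing_sequence_def by (rule order_tendstoD(2)[rotated])
  then obtain N where "\<And>i. i \<ge> N \<Longrightarrow> f (z i) < L"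
    by (auto simp: eventually_sequentially)
  hence "\<And>i. i \<ge> N \<Longrightarrow> norm (z i) \<le> R"
    using assms(3) by (simp add: less_imp_le)
  hence "bounded (z ` {N..})"
    unfolding bounded_iff by auto
  moreover have "bounded (z ` {..<N})"
    by (intro finite_imp_bounded) simp
  ultimately have "bounded (z ` ({..<N} \<union> {N..}))"
    by (simp add: image_Un)
  moreover have "{..<N} \<union> {N..} = UNIV"
    by auto
  ultimately show ?thesis
    by simp
qed

text \<open>A near-optimal \<open>Z\<close> fits \<open>A X\<close> so well that \<open>A Z\<close>, hence \<open>Z\<close>, has rank at least \<open>r\<close>; its value
  of \<open>owl21\<close> then keeps it away from the singularity set, where \<open>A\<close> is bounded below.\<close>
lemma objective_sublevel_bounded:
  fixes A :: "real^'n^'m" and X :: "real^'k^'n"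
  assumes rank: "rank (A ** X) = rank X" and X: "owl21 X < \<mu>"
    and gap: "\<And>Z :: real^'k^'n. Z \<in> singularity_set (rank X) A \<Longrightarrow> \<mu> < owl21 Z"
  obtains c0 \<alpha>0 where "c0 > 0" "\<alpha>0 > 0"
    "\<And>\<delta> \<alpha> Y. \<lbrakk>0 \<le> \<delta>; 0 < \<alpha>; \<delta>\<^sup>2 / \<alpha> \<le> c0; \<alpha> \<le> \<alpha>0; norm (Y - A ** X) \<le> \<delta>\<rbrakk> \<Longrightarrow>
      objective \<alpha> A Y X < \<mu> \<and> (\<exists>R. \<forall>Z :: real^'k^'n. objective \<alpha> A Y Z \<le> \<mu> \<longrightarrow> norm Z \<le> R)"
proof -
  obtain \<sigma> where \<sigma>: "\<sigma> > 0"
    "\<And>Z :: real^'k^'n. rank X \<le> rank Z \<Longrightarrow> owl21 Z \<le> \<mu> \<Longrightarrow> \<sigma> * norm Z \<le> norm (A ** Z)"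
    using norm_ge_below_singularity_set[OF gap] by blast
  obtain e where e: "e > 0" "\<And>B. norm (B - A ** X) < e \<Longrightarrow> rank (A ** X) \<le> rank B"
    using rank_lower_semicontinuous[of "A ** X"] by blast
  \<comment> \<open>The slack at \<open>X\<close>: with \<open>\<delta>\<close> squared at most
    \<open>c0 * \<alpha>\<close>, the fidelity term at \<open>X\<close> uses up at most half of
    it.\<close>
  define c0 where "c0 = \<mu> - owl21 X"
  have c0: "c0 > 0"
    using X by (simp add: c0_def)
  have \<mu>: "\<mu> > 0"
    using X owl21_nonneg[of X] by linarith
  \<comment> \<open>The summand with \<open>\<mu>\<close> forces the residual of a sublevel
    \<open>Z\<close> below \<open>e / 2\<close>, the one with \<open>c0\<close> forces
    \<open>\<delta> < e / 2\<close>; together they put \<open>A ** Z\<close> within \<open>e\<close>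
    of \<open>A ** X\<close>.\<close>
  define \<alpha>0 where "\<alpha>0 = e\<^sup>2 / (8 * \<mu> + 8 * c0)"
  have \<alpha>0: "\<alpha>0 > 0"
    using e(1) \<mu> c0 by (simp add: \<alpha>0_def)
  show thesis
  proof (rule that[OF c0 \<alpha>0])
    fix \<delta> \<alpha> and Y :: "real^'k^'m"
    assume \<delta>: "0 \<le> \<delta>" and \<alpha>: "0 < \<alpha>" and \<delta>\<alpha>: "\<delta>\<^sup>2 / \<alpha> \<le> c0" and le: "\<alpha> \<le> \<alpha>0"
      and Y: "norm (Y - A ** X) \<le> \<delta>"
    have \<delta>2: "\<delta>\<^sup>2 \<le> c0 * \<alpha>"
      using \<delta>\<alpha> \<alpha> by (simp add: divide_le_eq)
    have "8 * (\<mu> * \<alpha>) + 8 * (c0 * \<alpha>) \<le> e\<^sup>2"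
      using le \<mu> c0 by (simp add: \<alpha>0_def le_divide_eq algebra_simps)
    hence small: "8 * (\<mu> * \<alpha>) < e\<^sup>2" "8 * (c0 * \<alpha>) < e\<^sup>2"
      using mult_pos_pos[OF \<mu> \<alpha>] mult_pos_pos[OF c0 \<alpha>] by linarith+
    have "(norm (A ** X - Y))\<^sup>2 \<le> \<delta>\<^sup>2"
      using Y by (intro power_mono) (simp_all add: norm_minus_commute)
    hence "1 / (2 * \<alpha>) * (norm (A ** X - Y))\<^sup>2 \<le> c0 / 2"
      using \<delta>2 \<alpha> by (simp add: field_simps)
    hence "objective \<alpha> A Y X \<le> owl21 X + c0 / 2"
      by (simp add: objective_def)
    hence "objective \<alpha> A Y X < \<mu>"
      using X by (simp add: c0_def field_simps)
    moreover have "norm Z \<le> (e / 2 + norm Y) / \<sigma>" if Z: "objective \<alpha> A Y Z \<le> \<mu>" for Z :: "real^'k^'n"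
    proof -
      have fit: "0 \<le> 1 / (2 * \<alpha>) * (norm (A ** Z - Y))\<^sup>2"
        using \<alpha> by simp
      have owl: "owl21 Z \<le> \<mu>"
        using Z fit unfolding objective_def by linarith
      have "1 / (2 * \<alpha>) * (norm (A ** Z - Y))\<^sup>2 \<le> \<mu>"
        using Z owl21_nonneg[of Z] unfolding objective_def by linarith
      hence "(norm (A ** Z - Y))\<^sup>2 \<le> 2 * (\<mu> * \<alpha>)"
        using \<alpha> by (simp add: field_simps)
      hence "(norm (A ** Z - Y))\<^sup>2 < (e / 2)\<^sup>2"
        using small(1) by (simp add: power_divide)
      hence near: "norm (A ** Z - Y) < e / 2"
        by (rule power2_less_imp_less) (use e(1) in simp)
      have "4 * \<delta>\<^sup>2 < e\<^sup>2"
        using small(2) \<delta>2 zero_le_power2[of \<delta>] by linarith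
      hence "\<delta>\<^sup>2 < (e / 2)\<^sup>2"
        by (simp add: power_divide)
      hence "\<delta> < e / 2"
        by (rule power2_less_imp_less) (use e(1) in simp)
      hence "norm (A ** Z - A ** X) < e"
        using norm_triangle_ineq[of "A ** Z - Y" "Y - A ** X"] near Y by simp
      hence "rank X \<le> rank (A ** Z)"
        using e(2) rank by simp
      hence "rank X \<le> rank Z"
        using rank_mul_le_right[of A Z] by linarith
      hence "\<sigma> * norm Z \<le> norm (A ** Z)"
        using \<sigma>(2) owl by blast
      also have "\<dots> \<le> e / 2 + norm Y"
        using norm_triangle_sub[of "A ** Z" Y] near by simp
      finally show ?thesis
        using \<sigma>(1) by (simp add: le_divide_eq mult.commute)
    qed
    ultimately show "objective \<alpha> A Y X < \<mu> \<and>
        (\<exists>R. \<forall>Z :: real^'k^'n. objective \<alpha> A Y Z \<le> \<mu> \<longrightarrow> norm Z \<le> R)"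
      by blast
  qed
qed

theorem proposition4p8:
  fixes A :: "real^'n^'m" and X :: "real^'k^'n" and r s :: nat
  assumes "rank X = r" and "r \<ge> 1"
    and "card {n. row n X \<noteq> 0} = s"
  shows "((enat s < spark A \<and> spherical_section TYPE('k) r s A) \<longleftrightarrow>
          (r \<le> s \<and>
           ereal (real s) < min ((iota TYPE('k) r A)\<^sup>2 / ereal (real r)) (ereal_of_enat (spark A)))) \<and>
         (enat s < spark A \<and> spherical_section TYPE('k) r s A \<longrightarrow>
          (\<exists>c\<^sub>0>0. \<exists>\<alpha>\<^sub>0>0. \<forall>\<delta>\<ge>0. \<forall>\<alpha>>0. \<delta>\<^sup>2 / \<alpha> \<le> c\<^sub>0 \<longrightarrow> \<alpha> \<le> \<alpha>\<^sub>0 \<longrightarrow>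
             (\<forall>Y :: real^'k^'m. norm (Y - A ** X) \<le> \<delta> \<longrightarrow>
                (\<forall>Z :: nat \<Rightarrow> real^'k^'n.
                   minimizing_sequence (objective \<alpha> A Y) Z \<longrightarrow> bounded (range Z)) \<and>
                optimal_solutions (objective \<alpha> A Y) \<noteq> {})))"
proof (intro conjI impI)
  have "r \<le> s"
    using rank_le_card_nonzero_rows[of X] assms by simp
  moreover have "enat s < spark A \<longleftrightarrow> ereal (real s) < ereal_of_enat (spark A)"
    using ereal_of_enat_less_iff[of "enat s" "spark A"] by simp
  ultimately show "(enat s < spark A \<and> spherical_section TYPE('k) r s A) \<longleftrightarrow>
          (r \<le> s \<and>
           ereal (real s) < min ((iota TYPE('k) r A)\<^sup>2 / ereal (real r)) (ereal_of_enat (spark A)))"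
    using spherical_section_iff_iota[OF assms(2), of s A, where 'k = 'k] by auto
next
  assume *: "enat s < spark A \<and> spherical_section TYPE('k) r s A"
  obtain \<mu> where \<mu>: "sqrt (real r * real s) < \<mu>"
    "\<And>Z :: real^'k^'n. Z \<in> singularity_set r A \<Longrightarrow> \<mu> < owl21 Z"
    using spherical_section_gap * by blast
  have rank: "rank (A ** X) = rank X"
    using * assms(3) by (intro rank_mult_eq_of_less_spark) simp
  \<comment> \<open>The Cauchy-Schwarz bound \<open>sqrt (r s)\<close> for \<open>X\<close> meets
    the gap here, so the sublevel set at \<open>\<mu>\<close> can contain \<open>X\<close> with room
    to spare.\<close>
  have X: "owl21 X < \<mu>"
    using owl21_le_sqrt_rank_card_rows[of X] \<mu>(1) assms by simp
  obtain c0 \<alpha>0 where c0: "c0 > 0" and \<alpha>0: "\<alpha>0 > 0" and sub: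
    "\<And>\<delta> \<alpha> Y. \<lbrakk>0 \<le> \<delta>; 0 < \<alpha>; \<delta>\<^sup>2 / \<alpha> \<le> c0; \<alpha> \<le> \<alpha>0; norm (Y - A ** X) \<le> \<delta>\<rbrakk> \<Longrightarrow>
      objective \<alpha> A Y X < \<mu> \<and> (\<exists>R. \<forall>Z :: real^'k^'n. objective \<alpha> A Y Z \<le> \<mu> \<longrightarrow> norm Z \<le> R)"
    using objective_sublevel_bounded[OF rank X] \<mu>(2) assms(1) by blast
  show "\<exists>c\<^sub>0>0. \<exists>\<alpha>\<^sub>0>0. \<forall>\<delta>\<ge>0. \<forall>\<alpha>>0. \<delta>\<^sup>2 / \<alpha> \<le> c\<^sub>0 \<longrightarrow> \<alpha> \<le> \<alpha>\<^sub>0 \<longrightarrow>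
             (\<forall>Y :: real^'k^'m. norm (Y - A ** X) \<le> \<delta> \<longrightarrow>
                (\<forall>Z :: nat \<Rightarrow> real^'k^'n.
                   minimizing_sequence (objective \<alpha> A Y) Z \<longrightarrow> bounded (range Z)) \<and>
                optimal_solutions (objective \<alpha> A Y :: real^'k^'n \<Rightarrow> real) \<noteq> {})"
  proof (rule exI[of _ c0], intro conjI c0, rule exI[of _ \<alpha>0], intro conjI \<alpha>0 allI impI)
    fix \<delta> \<alpha> and Y :: "real^'k^'m"
    assume h: "0 \<le> \<delta>" "0 < \<alpha>" "\<delta>\<^sup>2 / \<alpha> \<le> c0" "\<alpha> \<le> \<alpha>0" "norm (Y - A ** X) \<le> \<delta>"
    obtain R where obj: "objective \<alpha> A Y X < \<mu>"
      and R: "\<And>Z :: real^'k^'n. objective \<alpha> A Y Z \<le> \<mu> \<Longrightarrow> norm Z \<le> R"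
      using sub[OF h] by blast
    show "optimal_solutions (objective \<alpha> A Y :: real^'k^'n \<Rightarrow> real) \<noteq> {}"
      using optimal_solutions_nonempty[OF h(2) less_imp_le[OF obj] R] by blast
    fix Z :: "nat \<Rightarrow> real^'k^'n"
    assume "minimizing_sequence (objective \<alpha> A Y) Z"
    moreover have "bdd_below (range (objective \<alpha> A Y :: real^'k^'n \<Rightarrow> real))"
      using objective_nonneg[OF h(2)] by (intro bdd_belowI[of _ 0]) auto
    ultimately show "bounded (range Z)"
      using minimizing_sequence_bounded obj R by blast
  qed
qed

end
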